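(* For each $s \in \mathbb{N}$ there exists a constant $C_1 = C_1(s)>0$ such that the following holds. Let $\Delta>0$, $\rho\ge 0$, $2\le \ell\le s$ and $\ell-1\le \tau\le \pi/\Delta$ satisfy $4\tau\Delta \le \min\left(\rho, \frac{1}{s^2}\right)$. Let $\boldsymbol{\xi}=(\xi_1,\dots,\xi_s)\subset \frac{1}{s^2}\left(-\frac{\pi}{2},\frac{\pi}{2}\right]$ form a $(\Delta,\rho,s,\ell,\tau)$-clustered configuration, and let $N\in\mathbb{N}$ satisfy \[ \max\left(\frac{4\pi s}{\rho},\,4s^3\right) \le N \le \frac{\pi s}{\tau\Delta}. \] Then \[ \sigma_{\min}\big(U_N(\boldsymbol{\xi})\big) \ge C_1\,(N\Delta)^{2\ell-1}. \]
   Context: For $N\in\mathbb{N}$ and pairwise distinct real nodes $\boldsymbol{\xi}=(\xi_1,\dots,\xi_s)$, $\xi_j\in(-\pi,\pi]$, put $z_j=e^{i\xi_j}$ and define the $(2N+1)\times 2s$ confluent Vandermonde matrix \[U_N(\boldsymbol{\xi}) = \frac{1}{\sqrt{2N}}\big[\, z_j^k \quad k z_j^{k-1}\,\big]^{j=1,\dots,s}_{k=0,\dots,2N},\] i.e. row $k$ ($k=0,\dots,2N$) has entries $z_1^k,\dots,z_s^k, kz_1^{k-1},\dots,kz_s^{k-1}$ (scaled by $1/\sqrt{2N}$). $\sigma_{\min}$ denotes the smallest singular value. Wraparound distance: $\|t\|_{\tilde{\mathbb{T}}}=|\mathrm{Arg}\,e^{it}|$, where $\mathrm{Arg}$ is the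 principal argument in $(-\pi,\pi]$. Clustered configuration: for $\Delta>0$, $2\le\ell\le s$, $\ell-1\le\tau\le\pi/\Delta$, $\rho\ge0$, a node vector $\boldsymbol{x}=(x_1,\dots,x_s)\subset(-\frac{\pi}{2},\frac{\pi}{2}]$ of distinct nodes forms a $(\Delta,\rho,s,\ell,\tau)$-clustered configuration if for each $x_j$ there is a subset $\boldsymbol{x}^{(j)}=\{x_{j,1},\dots,x_{j,r_j}\}\subset\boldsymbol{x}$ of $1\le r_j\le\ell$ distinct nodes with $x_{j,1}=x_j$ such that (1) $\Delta\le\|y-x_j\|_{\tilde{\mathbb{T}}}\le\tau\Delta$ for all $y\in\boldsymbol{x}^{(j)}\setminus\{x_j\}$, and (2) $\|y-x_j\|_{\tilde{\mathbb{T}}}\ge\rho$ for all $y\in\boldsymbol{x}\setminus\boldsymbol{x}^{(j)}$. *)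

theory Defs
  imports "HOL-Complex_Analysis.Complex_Analysis" "Jordan_Normal_Form.Schur_Decomposition"
begin

definition wrap_dist :: "real \<Rightarrow> real" where
  "wrap_dist t = \<bar>Arg (cis t)\<bar>"

definition clustered_config ::
  "real \<Rightarrow> real \<Rightarrow> nat \<Rightarrow> nat \<Rightarrow> real \<Rightarrow> (nat \<Rightarrow> real) \<Rightarrow> bool" where
  "clustered_config \<Delta> \<rho> s l \<tau> x \<longleftrightarrow>
     \<Delta> > 0 \<and> 2 \<le> l \<and> l \<le> s \<and> real l - 1 \<le> \<tau> \<and> \<tau> \<le> pi / \<Delta> \<and> \<rho> \<ge> 0 \<and>
     (\<forall>j<s. - pi / 2 < x j \<and> x j \<le> pi / 2) \<and>
     inj_on x {..<s} \<and>
     (\<forall>j<s. \<exists>R. R \<subseteq> {..<s} \<and> j \<in> R \<and> 1 \<le> card R \<and> card R \<le> l \<and>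
        (\<forall>y\<in>R - {j}. \<Delta> \<le> wrap_dist (x y - x j) \<and> wrap_dist (x y - x j) \<le> \<tau> * \<Delta>) \<and>
        (\<forall>y\<in>{..<s} - R. wrap_dist (x y - x j) \<ge> \<rho>))"

definition conf_vandermonde :: "nat \<Rightarrow> nat \<Rightarrow> (nat \<Rightarrow> real) \<Rightarrow> complex mat" where
  "conf_vandermonde N s \<xi> = mat (2 * N + 1) (2 * s) (\<lambda>(k, j).
     complex_of_real (1 / sqrt (2 * real N)) *
     (if j < s then cis (\<xi> j) ^ k
      else of_nat k * cis (\<xi> (j - s)) ^ (k - 1)))"

text \<open>Singular values of A (m x n, m >= n): square roots of the eigenvalues of A^H A
  (which are real and nonnegative); sigma_min is the smallest of them.\<close>
definition sigma_min :: "complex mat \<Rightarrow> real" where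
  "sigma_min A = Min {sqrt (Re e) | e. eigenvalue (mat_adjoint A * A) e}"

end

theory Submission
  imports Defs "Jordan_Normal_Form.Spectral_Radius"
begin

text \<open>
  The coefficients \<open>a\<^sub>i, b\<^sub>i\<close> of \<open>f k = \<Sum>i. a\<^sub>i z\<^sub>i^k + b\<^sub>i k z\<^sub>i^(k-1)\<close> are recovered by duality: pairing
  \<open>f\<close> with the coefficients of a polynomial \<open>p\<close> gives \<open>\<Sum>i. a\<^sub>i p(z\<^sub>i) + b\<^sub>i p'(z\<^sub>i)\<close>.
  To isolate the node \<open>w = z\<^sub>j\<close>, take the product \<open>T\<close> of the squares of
  \<open>(z^L\<^sub>i - z\<^sub>i^L\<^sub>i) / (w^L\<^sub>i - z\<^sub>i^L\<^sub>i)\<close> over \<open>i \<noteq> j\<close> with the average of \<open>(z/w)^m\<close> over \<open>m < M\<close>,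
  where \<open>M = \<lfloor>N/s\<rfloor>\<close>; multiplying \<open>T\<close> by \<open>(z^M - w^M) / (M w^(M-1))\<close> isolates \<open>b\<^sub>j\<close>.
  The exponents \<open>L\<^sub>i \<le> M\<close> may depend on \<open>i\<close>: for a node in the cluster of \<open>z\<^sub>j\<close>, \<open>L\<^sub>i = M\<close> makes
  the denominator at least a multiple of \<open>N\<Delta>\<close>, and for a node at distance \<open>\<delta> \<ge> \<rho>\<close>,
  \<open>L\<^sub>i = \<lfloor>\<pi>/\<delta>\<rfloor>\<close> makes it at least 1. The squared cluster factors contribute
  \<open>(N\<Delta>)^-(2l-2)\<close> and \<open>T'(w)\<close> one more factor \<open>(N\<Delta>)^-1\<close>, while the averaging factor, of
  coefficient norm \<open>1/sqrt M\<close>, compensates the normalization \<open>1/sqrt (2N)\<close>.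
\<close>

section \<open>The Euclidean norm of polynomial coefficients\<close>

text \<open>By Parseval this is the L2 norm on the unit circle. It is the norm dual to the Euclidean
  norm of a vector of samples.\<close>

definition coeff_norm :: "complex poly \<Rightarrow> real" where
  "coeff_norm p = L2_set (\<lambda>k. cmod (coeff p k)) {..degree p}"

text \<open>Padding with zero coefficients puts polynomials of different degrees on one index
  range.\<close>

lemma coeff_norm_eq:
  assumes "degree p \<le> n"
  shows "coeff_norm p = L2_set (\<lambda>k. cmod (coeff p k)) {..n}"
proof -
  have "(\<Sum>k\<le>degree p. (cmod (coeff p k))\<^sup>2) = (\<Sum>k\<le>n. (cmod (coeff p k))\<^sup>2)"
    using assms by (intro sum.mono_neutral_left) (auto simp: coeff_eq_0)
  then show ?thesis
    by (simp add: coeff_norm_def L2_set_def)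
qed

lemma coeff_norm_nonneg [simp]: "0 \<le> coeff_norm p"
  by (simp add: coeff_norm_def)

lemma coeff_norm_smult: "coeff_norm (Polynomial.smult c p) = cmod c * coeff_norm p"
proof -
  have "coeff_norm (Polynomial.smult c p)
      = L2_set (\<lambda>k. cmod c * cmod (coeff p k)) {..degree p}"
    by (subst coeff_norm_eq[of _ "degree p"]) (auto simp: norm_mult)
  also have "\<dots> = cmod c * coeff_norm p"
    by (simp add: coeff_norm_def L2_set_right_distrib)
  finally show ?thesis .
qed

lemma coeff_norm_diff_le: "coeff_norm (p - q) \<le> coeff_norm p + coeff_norm q"
proof -
  define n where "n = max (degree p) (degree q)"
  have "coeff_norm (p - q) = L2_set (\<lambda>k. cmod (coeff p k - coeff q k)) {..n}"
    by (subst coeff_norm_eq[of _ n]) (auto simp: n_def degree_diff_le_max)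
  also have "\<dots> \<le> L2_set (\<lambda>k. cmod (coeff p k) + cmod (coeff q k)) {..n}"
    by (intro L2_set_mono norm_triangle_ineq4) auto
  also have "\<dots> \<le> coeff_norm p + coeff_norm q"
    by (subst (1 2) coeff_norm_eq[of _ n]) (auto simp: n_def intro!: L2_set_triangle_ineq)
  finally show ?thesis .
qed

lemma coeff_norm_monom_mult: "coeff_norm (monom 1 m * p) = coeff_norm p"
proof -
  have "coeff_norm (monom 1 m * p)
      = L2_set (\<lambda>k. cmod (coeff (monom 1 m * p) k)) {..degree p + m}"
  proof (rule coeff_norm_eq)
    show "degree (monom 1 m * p) \<le> degree p + m"
      using degree_mult_le[of "monom 1 m" p] degree_monom_le[of "1::complex" m] by linarith
  qed
  also have "\<dots> = coeff_norm p"
  proof -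
    have "(\<Sum>k\<le>degree p + m. (cmod (coeff (monom 1 m * p) k))\<^sup>2)
        = (\<Sum>k\<in>{m..degree p + m}. (cmod (coeff (monom 1 m * p) k))\<^sup>2)"
      by (intro sum.mono_neutral_right) (auto simp: coeff_monom_mult)
    also have "\<dots> = (\<Sum>k\<le>degree p. (cmod (coeff p k))\<^sup>2)"
      by (rule sum.reindex_bij_witness[of _ "\<lambda>k. k + m" "\<lambda>k. k - m"])
        (auto simp: coeff_monom_mult)
    finally show ?thesis
      by (simp add: coeff_norm_def L2_set_def)
  qed
  finally show ?thesis .
qed

text \<open>Multiplication by \<open>z^m\<close> only shifts coefficients. For unimodular
  \<open>c\<close> the cost is therefore 2 whatever \<open>m\<close> is, which leaves the exponents
  free to be adapted to each node.\<close>

lemma coeff_norm_binomial_mult_le: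
  "coeff_norm ((monom 1 m - [:c:]) * p) \<le> (1 + cmod c) * coeff_norm p"
proof -
  have "coeff_norm ((monom 1 m - [:c:]) * p)
      = coeff_norm (monom 1 m * p - Polynomial.smult c p)"
    by (simp add: algebra_simps)
  also have "\<dots> \<le> coeff_norm p + cmod c * coeff_norm p"
    using coeff_norm_diff_le[of "monom 1 m * p" "Polynomial.smult c p"]
    by (simp add: coeff_norm_monom_mult coeff_norm_smult)
  finally show ?thesis by (simp add: algebra_simps)
qed

text \<open>The norm is not submultiplicative, so each factor enters as a multiplication operator
  with its own bound, and the factors are peeled off one by one.\<close>

lemma coeff_norm_prod_mult_le:
  assumes "finite I"
    and "\<And>i q. i \<in> I \<Longrightarrow> coeff_norm (f i * q) \<le> c i * coeff_norm q"
    and "\<And>i. i \<in> I \<Longrightarrow> 0 \<le> c i"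
  shows "coeff_norm (prod f I * p) \<le> prod c I * coeff_norm p"
  using assms
proof (induction I rule: finite_induct)
  case (insert i I)
  have "coeff_norm (prod f (insert i I) * p) = coeff_norm (f i * (prod f I * p))"
    using insert.hyps by (simp add: mult.assoc)
  also have "\<dots> \<le> c i * coeff_norm (prod f I * p)"
    by (intro insert.prems) auto
  also have "\<dots> \<le> c i * (prod c I * coeff_norm p)"
    by (intro mult_left_mono insert.IH insert.prems) auto
  finally show ?case
    using insert.hyps by (simp add: mult.assoc)
qed auto

section \<open>Evaluation of polynomials and duality with confluent exponential sums\<close>

lemma poly_pderiv_prod_of_eq_1:
  assumes "\<And>i. i \<in> I \<Longrightarrow> poly (f i) w = 1"
  shows "poly (pderiv (prod f I)) w = (\<Sum>i\<in>I. poly (pderiv (f i)) (w :: complex))"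
  by (simp add: pderiv_prod poly_sum poly_prod assms)

lemma poly_eq_sum_atMost:
  fixes p :: "complex poly"
  assumes "degree p \<le> n"
  shows "poly p z = (\<Sum>k\<le>n. coeff p k * z ^ k)"
  unfolding poly_altdef using assms
  by (intro sum.mono_neutral_left) (auto simp: coeff_eq_0)

text \<open>The truncated exponent \<open>k - 1\<close> is harmless at \<open>k = 0\<close> because
  of the factor \<open>k\<close>. This is the form of the derivative columns of the matrix.\<close>

lemma poly_pderiv_eq_sum_atMost:
  fixes p :: "complex poly"
  assumes "degree p \<le> n"
  shows "poly (pderiv p) z = (\<Sum>k\<le>n. coeff p k * (of_nat k * z ^ (k - 1)))"
proof (cases n)
  case 0
  then have "pderiv p = 0"
    using assms by (simp add: pderiv_eq_0_iff)
  then show ?thesis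
    using 0 by simp
next
  case (Suc m)
  have "poly (pderiv p) z = (\<Sum>k\<le>m. coeff (pderiv p) k * z ^ k)"
    using assms Suc by (intro poly_eq_sum_atMost) (simp add: degree_pderiv)
  also have "\<dots> = (\<Sum>k\<le>n. coeff p k * (of_nat k * z ^ (k - 1)))"
    unfolding Suc sum.atMost_Suc_shift by (simp add: coeff_pderiv algebra_simps)
  finally show ?thesis .
qed

text \<open>Expanding \<open>p\<close> and exchanging the sums pairs its coefficients with the
  samples \<open>f k\<close>; then Cauchy-Schwarz applies.\<close>

lemma norm_functional_le:
  fixes a b z :: "nat \<Rightarrow> complex" and s :: nat
  assumes "degree p \<le> n"
  defines "f \<equiv> \<lambda>k. \<Sum>i<s. a i * z i ^ k + b i * (of_nat k * z i ^ (k - 1))"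
  shows "cmod (\<Sum>i<s. a i * poly p (z i) + b i * poly (pderiv p) (z i))
    \<le> coeff_norm p * L2_set (\<lambda>k. cmod (f k)) {..n}"
proof -
  have "(\<Sum>i<s. a i * poly p (z i) + b i * poly (pderiv p) (z i)) =
      (\<Sum>i<s. \<Sum>k\<le>n. coeff p k * (a i * z i ^ k + b i * (of_nat k * z i ^ (k - 1))))"
    unfolding poly_eq_sum_atMost[OF assms(1)] poly_pderiv_eq_sum_atMost[OF assms(1)]
    by (simp add: sum_distrib_left sum.distrib algebra_simps)
  also have "\<dots> = (\<Sum>k\<le>n. coeff p k * f k)"
    unfolding f_def sum_distrib_left by (rule sum.swap)
  also have "cmod \<dots> \<le> (\<Sum>k\<le>n. \<bar>cmod (coeff p k)\<bar> * \<bar>cmod (f k)\<bar>)"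
    by (rule order_trans[OF norm_sum]) (simp add: norm_mult)
  also have "\<dots> \<le> coeff_norm p * L2_set (\<lambda>k. cmod (f k)) {..n}"
    unfolding coeff_norm_eq[OF assms(1)] by (rule L2_set_mult_ineq)
  finally show ?thesis .
qed

section \<open>Chords and distances on the circle\<close>

text \<open>Jordan's inequality: \<open>sin\<close> is concave on \<open>[0, pi]\<close>, so it lies
  above its chord from 0 to \<open>pi / 2\<close>.\<close>

lemma sin_ge_linear: "2 / pi * x \<le> sin x" if "0 \<le> x" "x \<le> pi / 2"
proof -
  have cvx: "convex_on {0..pi} (\<lambda>x. - sin x)"
    by (rule f''_ge0_imp_convex[where f' = "\<lambda>x. - cos x" and f'' = sin])
      (auto intro!: derivative_eq_intros sin_ge_zero)
  define t where "t = 2 / pi * x"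
  have t: "0 \<le> t" "t \<le> 1" "t * (pi / 2) = x"
    using that by (auto simp: t_def field_simps)
  have "- sin ((1 - t) *\<^sub>R 0 + t *\<^sub>R (pi / 2)) \<le> (1 - t) * (- sin 0) + t * (- sin (pi / 2))"
    by (rule convex_onD[OF cvx]) (use t in auto)
  then show ?thesis
    using t by (simp add: t_def)
qed

text \<open>The chord has length \<open>2 * \<bar>sin ((x - y) / 2)\<bar>\<close>, to which Jordan's
  inequality applies.\<close>

lemma norm_cis_diff_ge:
  assumes "\<bar>x - y\<bar> \<le> pi"
  shows "2 / pi * \<bar>x - y\<bar> \<le> cmod (cis x - cis y)"
proof -
  have "cis x - cis y = cis y * (cis (x - y) - 1)"
    by (simp add: algebra_simps cis_mult)
  then have "cmod (cis x - cis y) = cmod (exp (\<i> * of_real (x - y)) - 1)"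
    by (simp add: norm_mult cis_conv_exp)
  also have "\<dots> = 2 * \<bar>sin ((x - y) / 2)\<bar>"
    by (rule dist_exp_i_1)
  also have "\<bar>sin ((x - y) / 2)\<bar> = \<bar>sin (\<bar>x - y\<bar> / 2)\<bar>"
    using sin_minus[of "(x - y) / 2"] by (simp add: abs_if minus_divide_left)
  also have "2 * \<bar>sin (\<bar>x - y\<bar> / 2)\<bar> \<ge> 2 / pi * \<bar>x - y\<bar>"
    using order_trans[OF sin_ge_linear[of "\<bar>x - y\<bar> / 2"] abs_ge_self] assms by simp
  finally show ?thesis .
qed

lemma wrap_dist_eq_abs:
  assumes "\<bar>t\<bar> < pi"
  shows "wrap_dist t = \<bar>t\<bar>"
  using assms unfolding wrap_dist_def by (subst Arg_cis) auto

section \<open>Lower bounds for the smallest singular value\<close>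

text \<open>Pairing the eigenvalue equation with \<open>v\<close> and moving the adjoint across
  turns the left factor \<open>A\<close> into a second copy of \<open>A v\<close>.\<close>

lemma norm_gram_eigenvector:
  assumes "A \<in> carrier_mat m n" and "v \<in> carrier_vec n" and "mat_adjoint A * A *\<^sub>v v = e \<cdot>\<^sub>v v"
  shows "e * of_real (\<Sum>i<n. (cmod (vec_index v i))\<^sup>2)
    = of_real (\<Sum>k<m. (cmod (vec_index (A *\<^sub>v v) k))\<^sup>2)"
proof -
  define w where "w = A *\<^sub>v v"
  have dim: "mat_adjoint A \<in> carrier_mat n m"
    using assms(1) unfolding mat_adjoint_def by auto
  have wc: "w \<in> carrier_vec m" and dv: "dim_vec v = n"
    using assms(1,2) unfolding w_def by auto
  have ev: "e * vec_index v i = (\<Sum>k<m. cnj (A $$ (k, i)) * vec_index w k)" if i: "i < n" for i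
  proof -
    have "e * vec_index v i = vec_index (e \<cdot>\<^sub>v v) i"
      using i dv by simp
    also have "e \<cdot>\<^sub>v v = mat_adjoint A *\<^sub>v w"
      using assms dim unfolding w_def by (metis assoc_mult_mat_vec)
    also have "vec_index \<dots> i = (\<Sum>k<m. cnj (A $$ (k, i)) * vec_index w k)"
      using i assms(1) wc dim
      by (auto simp: mat_adjoint_def scalar_prod_def lessThan_atLeast0 intro!: sum.cong)
    finally show ?thesis .
  qed
  have wk: "vec_index w k = (\<Sum>i<n. A $$ (k, i) * vec_index v i)" if "k < m" for k
    using that assms(1) dv unfolding w_def
    by (auto simp: scalar_prod_def lessThan_atLeast0 intro!: sum.cong)
  have "e * of_real (\<Sum>i<n. (cmod (vec_index v i))\<^sup>2)
      = (\<Sum>i<n. (e * vec_index v i) * cnj (vec_index v i))"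
    by (simp add: sum_distrib_left complex_norm_square mult.assoc del: of_real_power)
  also have "\<dots> = (\<Sum>i<n. \<Sum>k<m. vec_index w k * cnj (A $$ (k, i) * vec_index v i))"
    by (intro sum.cong refl) (simp add: ev sum_distrib_left sum_distrib_right mult_ac)
  also have "\<dots> = (\<Sum>k<m. vec_index w k * cnj (\<Sum>i<n. A $$ (k, i) * vec_index v i))"
    by (subst sum.swap) (simp add: sum_distrib_left)
  also have "\<dots> = (\<Sum>k<m. vec_index w k * cnj (vec_index w k))"
    by (intro sum.cong refl) (simp add: wk)
  also have "\<dots> = of_real (\<Sum>k<m. (cmod (vec_index w k))\<^sup>2)"
    by (simp add: complex_norm_square del: of_real_power)
  finally show ?thesis
    unfolding w_def .
qed

text \<open>The spectrum of the Gram matrix is finite and nonempty, so it suffices to bound each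
  eigenvalue through the Rayleigh quotient of an eigenvector.\<close>

lemma sigma_min_ge:
  assumes A: "A \<in> carrier_mat m n" and n: "0 < n" and c: "0 \<le> c"
    and le: "\<And>v. v \<in> carrier_vec n \<Longrightarrow>
      c * L2_set (\<lambda>i. cmod (vec_index v i)) {..<n} \<le> L2_set (\<lambda>k. cmod (vec_index (A *\<^sub>v v) k)) {..<m}"
  shows "c \<le> sigma_min A"
proof -
  have G: "mat_adjoint A * A \<in> carrier_mat n n"
    using A unfolding mat_adjoint_def by auto
  define E where "E = {sqrt (Re e) | e. eigenvalue (mat_adjoint A * A) e}"
  have E: "E = (\<lambda>e. sqrt (Re e)) ` spectrum (mat_adjoint A * A)"
    unfolding E_def spectrum_def by auto
  have "finite E" "E \<noteq> {}"
    unfolding E using card_finite_spectrum[OF G] spectrum_non_empty[OF G] n by auto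
  moreover have "c \<le> x" if "x \<in> E" for x
  proof -
    obtain e where e: "eigenvalue (mat_adjoint A * A) e" "x = sqrt (Re e)"
      using \<open>x \<in> E\<close> unfolding E_def by auto
    then obtain v where v: "v \<in> carrier_vec n" "v \<noteq> 0\<^sub>v n" "mat_adjoint A * A *\<^sub>v v = e \<cdot>\<^sub>v v"
      using G unfolding eigenvalue_def eigenvector_def by auto
    define V W where "V = (\<Sum>i<n. (cmod (vec_index v i))\<^sup>2)"
      and "W = (\<Sum>k<m. (cmod (vec_index (A *\<^sub>v v) k))\<^sup>2)"
    have eq: "e * of_real V = of_real W"
      unfolding V_def W_def by (rule norm_gram_eigenvector[OF A v(1,3)])
    have "Re e * V = W"
      using arg_cong[OF eq, of Re] by simp
    moreover have "V > 0"
    proof -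
      obtain i where "i < n" "vec_index v i \<noteq> 0"
        using v(1,2) by (metis carrier_vecD eq_vecI index_zero_vec)
      then show ?thesis
        unfolding V_def by (intro sum_pos2[of _ i]) auto
    qed
    moreover have "c * sqrt V \<le> sqrt W"
      using le[OF v(1)] by (simp add: L2_set_def V_def W_def)
    \<comment> \<open>\<open>sqrt\<close> is multiplicative on all reals, so the sign of
      \<open>Re e\<close> does not have to be settled first.\<close>
    ultimately have "c * sqrt V \<le> sqrt (Re e) * sqrt V"
      by (metis real_sqrt_mult)
    then show ?thesis
      using \<open>V > 0\<close> e(2) by simp
  qed
  ultimately show ?thesis
    unfolding sigma_min_def E_def[symmetric] by (subst Min_ge_iff) auto
qed

section \<open>Averaging polynomials and node factors\<close>

text \<open>Among polynomials of degree below \<open>M\<close> with value 1 at a unimodular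
  \<open>w\<close>, equal coefficient moduli minimize the Euclidean norm, by Cauchy-Schwarz.\<close>

definition averaging_poly :: "nat \<Rightarrow> complex \<Rightarrow> complex poly" where
  "averaging_poly M w = (\<Sum>m<M. monom (1 / (of_nat M * w ^ m)) m)"

lemma coeff_averaging_poly:
  "coeff (averaging_poly M w) k = (if k < M then 1 / (of_nat M * w ^ k) else 0)"
  by (simp add: averaging_poly_def coeff_sum if_distrib cong: if_cong)

lemma degree_averaging_poly: "degree (averaging_poly M w) \<le> M"
  by (rule degree_le) (simp add: coeff_averaging_poly)

lemma
  assumes "cmod w = 1" and "0 < M"
  shows coeff_norm_averaging_poly: "coeff_norm (averaging_poly M w) = 1 / sqrt M"
    and poly_averaging_poly: "poly (averaging_poly M w) w = 1"
    and norm_pderiv_averaging_poly: "cmod (poly (pderiv (averaging_poly M w)) w) \<le> M"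
proof -
  have w: "w \<noteq> 0"
    using assms by auto
  have c: "cmod (coeff (averaging_poly M w) k) = (if k < M then 1 / M else 0)" for k
    using assms by (simp add: coeff_averaging_poly norm_divide norm_mult norm_power)
  have "(\<Sum>k\<le>M. (cmod (coeff (averaging_poly M w) k))\<^sup>2) = (\<Sum>k<M. (1 / real M)\<^sup>2)"
    by (rule sum.mono_neutral_cong_right) (auto simp: c)
  also have "\<dots> = 1 / M"
    using assms by (simp add: power2_eq_square)
  finally show "coeff_norm (averaging_poly M w) = 1 / sqrt M"
    by (simp add: coeff_norm_eq[OF degree_averaging_poly] L2_set_def real_sqrt_divide)
  show "poly (averaging_poly M w) w = 1"
    using assms w by (simp add: averaging_poly_def poly_sum poly_monom)
  have "cmod (poly (pderiv (averaging_poly M w)) w)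
      \<le> (\<Sum>k\<le>M. cmod (coeff (averaging_poly M w) k * (of_nat k * w ^ (k - 1))))"
    unfolding poly_pderiv_eq_sum_atMost[OF degree_averaging_poly] by (rule norm_sum)
  also have "\<dots> = (\<Sum>k<M. real k / M)"
    by (rule sum.mono_neutral_cong_right)
      (use assms in \<open>auto simp: c norm_mult norm_power\<close>)
  also have "\<dots> \<le> (\<Sum>k<M. 1)"
    using assms by (intro sum_mono) auto
  finally show "cmod (poly (pderiv (averaging_poly M w)) w) \<le> M"
    by simp
qed

text \<open>The normalization makes the value at \<open>w\<close> equal to 1. If
  \<open>w^L = u^L\<close>, division by zero yields the zero polynomial, which still vanishes at
  \<open>u\<close>.\<close>

definition node_factor :: "complex \<Rightarrow> complex \<Rightarrow> nat \<Rightarrow> complex poly" where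
  "node_factor w u L = Polynomial.smult (1 / (w ^ L - u ^ L)) (monom 1 L - [:u ^ L:])"

lemma degree_node_factor: "degree (node_factor w u L) \<le> L"
  unfolding node_factor_def
  by (intro order_trans[OF degree_smult_le] degree_diff_le degree_monom_le) auto

lemma poly_node_factor_root: "poly (node_factor w u L) u = 0"
  by (simp add: node_factor_def poly_monom)

lemma poly_node_factor: "w ^ L \<noteq> u ^ L \<Longrightarrow> poly (node_factor w u L) w = 1"
  by (simp add: node_factor_def poly_monom)

lemma norm_pderiv_node_factor:
  assumes "cmod w = 1" and "0 < d" and "d \<le> cmod (w ^ L - u ^ L)"
  shows "cmod (poly (pderiv (node_factor w u L)) w) \<le> L / d"
proof -
  have "cmod (poly (pderiv (node_factor w u L)) w) = L / cmod (w ^ L - u ^ L)"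
    using assms
    by (simp add: node_factor_def pderiv_smult pderiv_diff pderiv_monom pderiv_pCons
        poly_monom norm_divide norm_mult norm_power)
  also have "\<dots> \<le> L / d"
    using assms by (intro divide_left_mono mult_pos_pos) auto
  finally show ?thesis .
qed

lemma coeff_norm_node_factor_mult:
  assumes "cmod u = 1" and "0 < d" and "d \<le> cmod (w ^ L - u ^ L)"
  shows "coeff_norm (node_factor w u L * p) \<le> 2 / d * coeff_norm p"
proof -
  have "coeff_norm (node_factor w u L * p)
      = coeff_norm ((monom 1 L - [:u ^ L:]) * p) / cmod (w ^ L - u ^ L)"
    unfolding node_factor_def mult_smult_left coeff_norm_smult by (simp add: norm_divide)
  also have "\<dots> \<le> (2 * coeff_norm p) / d"
    using assms coeff_norm_binomial_mult_le[of L "u ^ L" p]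
    by (intro frac_le) (auto simp: norm_power)
  finally show ?thesis by simp
qed

section \<open>Dual polynomials isolating the coefficients at one node\<close>

text \<open>\<open>S\<close> has \<open>S(w) = 0\<close> and \<open>S'(w) = 1\<close>, hence returns
  \<open>b j\<close>; \<open>T\<close> has \<open>T(w) = 1\<close>, hence returns
  \<open>a j + b j * T'(w)\<close>. Both have double zeros at all other nodes.\<close>

lemma dual_polynomial_bounds:
  fixes a b z :: "nat \<Rightarrow> complex" and d :: "nat \<Rightarrow> real" and L :: "nat \<Rightarrow> nat"
  assumes unit: "\<And>i. i < s \<Longrightarrow> cmod (z i) = 1"
    and j: "j < s" and M: "0 < M" and n: "2 * s * M \<le> n"
    and L: "\<And>i. i \<in> {..<s} - {j} \<Longrightarrow> L i \<le> M"
    and d: "\<And>i. i \<in> {..<s} - {j} \<Longrightarrow> 0 < d i"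
      "\<And>i. i \<in> {..<s} - {j} \<Longrightarrow> d i \<le> cmod (z j ^ L i - z i ^ L i)"
  defines "G \<equiv> (\<Prod>i\<in>{..<s} - {j}. (2 / d i)\<^sup>2) / sqrt M"
    and "F \<equiv> L2_set (\<lambda>k. cmod (\<Sum>i<s. a i * z i ^ k + b i * (of_nat k * z i ^ (k - 1)))) {..n}"
  shows "cmod (b j) \<le> 2 / M * G * F"
    and "cmod (a j) \<le> G * F + cmod (b j) * ((\<Sum>i\<in>{..<s} - {j}. 2 * L i / d i) + M)"
proof -
  define I where "I = {..<s} - {j}"
  define w where "w = z j"
  \<comment> \<open>Squaring gives a double zero at \<open>z i\<close>, which kills the value and
    the derivative there.\<close>
  define B where "B i = (node_factor w (z i) (L i))\<^sup>2" for i
  define T where "T = prod B I * averaging_poly M w"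
  \<comment> \<open>\<open>M * w^(M-1)\<close> is the derivative of the binomial at
    \<open>w\<close>, so \<open>S'(w) = T(w) = 1\<close>.\<close>
  define S where "S = Polynomial.smult (1 / (of_nat M * w ^ (M - 1))) ((monom 1 M - [:w ^ M:]) * T)"
  have w: "cmod w = 1" "w \<noteq> 0"
    using unit[OF j] unfolding w_def by auto
  have finI: "finite I" and cardI: "Suc (card I) = s"
    using j by (auto simp: I_def)
  have neq: "w ^ L i \<noteq> z i ^ L i" if "i \<in> I" for i
    using d[of i] that unfolding I_def w_def by auto
  have zI: "cmod (z i) = 1" if "i \<in> I" for i
    using that unit by (auto simp: I_def)
  have dI: "0 < d i" "d i \<le> cmod (w ^ L i - z i ^ L i)" if "i \<in> I" for i
    using d that by (auto simp: I_def w_def)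

  have B1: "poly (B i) w = 1" if "i \<in> I" for i
    using poly_node_factor[OF neq[OF that]] by (simp add: B_def)
  have pderiv_B: "cmod (poly (pderiv (B i)) w) \<le> 2 * L i / d i" if "i \<in> I" for i
    using norm_pderiv_node_factor[OF w(1) dI[OF that]] poly_node_factor[OF neq[OF that]]
    by (simp add: B_def power2_eq_square pderiv_mult norm_mult flip: mult_2)

  have Tw: "poly T w = 1"
    by (simp add: T_def poly_prod B1 poly_averaging_poly[OF w(1) M])
  have pderiv_T: "cmod (poly (pderiv T) w) \<le> (\<Sum>i\<in>I. 2 * L i / d i) + M"
  proof -
    have "poly (pderiv T) w
        = (\<Sum>i\<in>I. poly (pderiv (B i)) w) + poly (pderiv (averaging_poly M w)) w"
      by (simp add: T_def pderiv_mult poly_pderiv_prod_of_eq_1 B1 poly_prod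
          poly_averaging_poly[OF w(1) M])
    also have "cmod \<dots> \<le> (\<Sum>i\<in>I. 2 * L i / d i) + M"
      by (intro norm_triangle_le add_mono norm_pderiv_averaging_poly w M
          order_trans[OF norm_sum] sum_mono pderiv_B)
    finally show ?thesis .
  qed

  have T0: "poly T (z i) = 0" "poly (pderiv T) (z i) = 0" if "i \<in> I" for i
  proof -
    have T: "T = node_factor w (z i) (L i) *
        (node_factor w (z i) (L i) * (prod B (I - {i}) * averaging_poly M w))"
      unfolding T_def prod.remove[OF finI that] by (simp add: B_def power2_eq_square mult.assoc)
    show "poly T (z i) = 0"
      by (subst T) (simp add: poly_node_factor_root)
    show "poly (pderiv T) (z i) = 0"
      by (subst T) (simp add: pderiv_mult poly_node_factor_root)
  qed

  have norm_T: "coeff_norm T \<le> G"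
  proof -
    have B: "coeff_norm (B i * q) \<le> (2 / d i)\<^sup>2 * coeff_norm q" if "i \<in> I" for i q
    proof -
      have "coeff_norm (B i * q) \<le> 2 / d i * coeff_norm (node_factor w (z i) (L i) * q)"
        unfolding B_def power2_eq_square mult.assoc
        by (rule coeff_norm_node_factor_mult[OF zI[OF that] dI[OF that]])
      also have "\<dots> \<le> 2 / d i * (2 / d i * coeff_norm q)"
        using dI(1)[OF that]
        by (intro mult_left_mono coeff_norm_node_factor_mult[OF zI[OF that] dI[OF that]]) auto
      finally show ?thesis by (simp add: power2_eq_square)
    qed
    show ?thesis
      unfolding T_def G_def
      using coeff_norm_prod_mult_le[where I = I and f = B and p = "averaging_poly M w" and c = "\<lambda>i. (2 / d i)\<^sup>2", OF finI B]
      by (simp add: coeff_norm_averaging_poly[OF w(1) M] I_def)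
  qed
  have G0: "0 \<le> G"
    using norm_T coeff_norm_nonneg order_trans by blast
  have F0: "0 \<le> F"
    by (simp add: F_def)

  have deg_T: "degree T \<le> 2 * (card I * M) + M"
  proof -
    have "degree (B i) \<le> 2 * M" if "i \<in> I" for i
      using degree_power_le[of "node_factor w (z i) (L i)" 2] degree_node_factor[of w "z i" "L i"]
        L[of i] that by (auto simp: B_def I_def)
    then have "sum (degree \<circ> B) I \<le> card I * (2 * M)"
      by (intro order_trans[OF sum_bounded_above[of I _ "2 * M"]]) auto
    then have "degree (prod B I) \<le> 2 * (card I * M)"
      using degree_prod_sum_le[OF finI, of B] by simp
    then show ?thesis
      unfolding T_def
      by (intro order_trans[OF degree_mult_le] add_mono degree_averaging_poly)
  qed
  \<comment> \<open>The count is \<open>M + 2 * (s - 1) * M + M = 2 * s * M\<close>: binomial,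
    squared node factors, averaging factor.\<close>
  have deg_S: "degree S \<le> n"
  proof -
    have "degree (monom 1 M - [:w ^ M:]) \<le> M"
      by (intro degree_diff_le degree_monom_le) auto
    then have "degree S \<le> M + (2 * (card I * M) + M)"
      unfolding S_def
      by (intro order_trans[OF degree_smult_le] order_trans[OF degree_mult_le] add_mono deg_T)
    also have "\<dots> = 2 * s * M"
      by (subst cardI[symmetric]) (simp add: algebra_simps)
    finally show ?thesis using n by simp
  qed
  have deg_T': "degree T \<le> n"
  proof -
    have "2 * (card I * M) + M \<le> 2 * s * M"
      by (subst cardI[symmetric]) (simp add: algebra_simps)
    then show ?thesis using deg_T n by linarith
  qed

  have functional: "(\<Sum>i<s. a i * poly p (z i) + b i * poly (pderiv p) (z i))
      = a j * poly p w + b j * poly (pderiv p) w"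
    if "\<And>i. i \<in> I \<Longrightarrow> poly p (z i) = 0" "\<And>i. i \<in> I \<Longrightarrow> poly (pderiv p) (z i) = 0" for p
    using that j by (subst sum.remove[of _ j]) (auto simp: I_def w_def)

  have "a j * poly S w + b j * poly (pderiv S) w = b j"
    using w M by (simp add: S_def poly_monom Tw pderiv_smult pderiv_mult pderiv_diff
        pderiv_monom pderiv_pCons)
  moreover have "(\<Sum>i<s. a i * poly S (z i) + b i * poly (pderiv S) (z i))
      = a j * poly S w + b j * poly (pderiv S) w"
    by (rule functional) (simp_all add: S_def pderiv_smult pderiv_mult T0)
  ultimately have "cmod (b j) \<le> coeff_norm S * F"
    using norm_functional_le[OF deg_S, where a = a and b = b and z = z and s = s] by (simp add: F_def)
  moreover have "coeff_norm S \<le> 2 / M * G"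
  proof -
    have "coeff_norm S = coeff_norm ((monom 1 M - [:w ^ M:]) * T) / M"
      unfolding S_def coeff_norm_smult using w by (simp add: norm_divide norm_mult norm_power)
    also have "\<dots> \<le> 2 * G / M"
      using norm_T coeff_norm_binomial_mult_le[of M "w ^ M" T] w
      by (intro divide_right_mono) (auto simp: norm_power)
    finally show ?thesis by simp
  qed
  ultimately show "cmod (b j) \<le> 2 / M * G * F"
    using mult_right_mono[OF _ F0] order_trans by blast

  have "(\<Sum>i<s. a i * poly T (z i) + b i * poly (pderiv T) (z i))
      = a j + b j * poly (pderiv T) w"
    using functional[OF T0] by (simp add: Tw)
  then have "cmod (a j + b j * poly (pderiv T) w) \<le> coeff_norm T * F"
    using norm_functional_le[OF deg_T', where a = a and b = b and z = z and s = s] by (simp add: F_def)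
  also have "\<dots> \<le> G * F"
    by (intro mult_right_mono norm_T F0)
  \<comment> \<open>The contribution of \<open>T'(w)\<close> is moved to the right, where the bound
    on \<open>b j\<close> will control it.\<close>
  finally have "cmod (a j) \<le> G * F + cmod (b j * poly (pderiv T) w)"
    using norm_triangle_ineq4[of "a j + b j * poly (pderiv T) w" "b j * poly (pderiv T) w"] by simp
  also have "\<dots> \<le> G * F + cmod (b j) * ((\<Sum>i\<in>I. 2 * L i / d i) + M)"
    unfolding norm_mult by (intro add_left_mono mult_left_mono pderiv_T) auto
  finally show "cmod (a j) \<le> G * F + cmod (b j) * ((\<Sum>i\<in>{..<s} - {j}. 2 * L i / d i) + M)"
    by (simp add: I_def)
qed

section \<open>Separation of powers of nodes\<close>

lemma norm_cis_power_diff_ge: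
  assumes "real L * \<bar>x - y\<bar> \<le> pi"
  shows "2 / pi * (real L * \<bar>x - y\<bar>) \<le> cmod (cis x ^ L - cis y ^ L)"
proof -
  have "real L * \<bar>x - y\<bar> = \<bar>real L * x - real L * y\<bar>"
    by (simp add: abs_mult flip: right_diff_distrib)
  then show ?thesis
    using norm_cis_diff_ge[of "real L * x" "real L * y"] assms by (simp add: Complex.DeMoivre)
qed

text \<open>The largest multiple of the distance not exceeding \<open>pi\<close> misses
  \<open>pi\<close> by less than one distance, so it is at least \<open>pi / 2\<close>.\<close>

lemma exponent_separating_far:
  assumes "0 < \<bar>x - y\<bar>" and "\<bar>x - y\<bar> \<le> pi / 2"
  shows "1 \<le> cmod (cis x ^ nat \<lfloor>pi / \<bar>x - y\<bar>\<rfloor> - cis y ^ nat \<lfloor>pi / \<bar>x - y\<bar>\<rfloor>)"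
proof -
  define \<delta> L where "\<delta> = \<bar>x - y\<bar>" and "L = nat \<lfloor>pi / \<delta>\<rfloor>"
  have \<delta>: "0 < \<delta>" "\<delta> \<le> pi / 2"
    using assms by (auto simp: \<delta>_def)
  then have L: "real L = of_int \<lfloor>pi / \<delta>\<rfloor>"
    by (simp add: L_def)
  then have "real L \<le> pi / \<delta>" "pi / \<delta> < real L + 1"
    by linarith+
  then have "real L * \<delta> \<le> pi" "pi < real L * \<delta> + \<delta>"
    using \<delta> by (simp_all add: field_simps)
  then have "pi / 2 \<le> real L * \<delta>" "real L * \<delta> \<le> pi"
    using \<delta> by auto
  then have "1 \<le> 2 / pi * (real L * \<delta>)"
    by (simp add: field_simps)
  also have "\<dots> \<le> cmod (cis x ^ L - cis y ^ L)"
    unfolding \<delta>_def by (rule norm_cis_power_diff_ge) (use \<open>real L * \<delta> \<le> pi\<close> in \<open>simp add: \<delta>_def\<close>)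
  finally show ?thesis
    by (simp add: L_def \<delta>_def)
qed

text \<open>Only nodes in \<open>R\<close> contribute \<open>1 / h\<close>, and
  \<open>1 / h \<ge> 1\<close> allows their number to be rounded up to \<open>m\<close>.\<close>

lemma prod_cluster_le:
  fixes h :: real
  assumes "finite I" and "0 < h" and "h \<le> 1" and "card (I \<inter> R) \<le> m" and "card I \<le> s"
  shows "(\<Prod>i\<in>I. (2 / (if i \<in> R then h else 1))\<^sup>2) \<le> 4 ^ s * (1 / h) ^ (2 * m)"
proof -
  have "(\<Prod>i\<in>I. (2 / (if i \<in> R then h else 1))\<^sup>2)
      = (\<Prod>i\<in>I. 4 * (if i \<in> R then (1 / h)\<^sup>2 else 1))"
    by (intro prod.cong) (auto simp: power_divide)
  also have "\<dots> = 4 ^ card I * ((1 / h)\<^sup>2) ^ card (I \<inter> R)"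
    using assms(1) by (simp add: prod.distrib prod.inter_restrict[symmetric])
  also have "\<dots> \<le> 4 ^ s * ((1 / h)\<^sup>2) ^ m"
    using assms by (intro mult_mono power_increasing) (auto intro: one_le_power)
  finally show ?thesis
    by (simp add: power_mult)
qed

section \<open>Coefficient bounds for clustered nodes\<close>

text \<open>The cluster geometry supplies exponents and denominators for the dual polynomials. Both
  bounds have the same form so that the whole coefficient vector can be treated uniformly.\<close>

lemma cluster_coefficient_bounds:
  fixes a b :: "nat \<Rightarrow> complex" and \<Delta> \<rho> \<tau> :: real and l s N :: nat
  assumes conf: "clustered_config \<Delta> \<rho> s l \<tau> \<xi>"
    and \<rho>: "4 * \<tau> * \<Delta> \<le> \<rho>"
    and box: "\<And>i. i < s \<Longrightarrow> \<bar>\<xi> i\<bar> \<le> pi / (2 * (real s)\<^sup>2)"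
    and N: "4 * pi * s / \<rho> \<le> N" "4 * real s ^ 3 \<le> N" "N \<le> pi * s / (\<tau> * \<Delta>)"
    and j: "j < s"
  defines "h \<equiv> N * \<Delta> / (pi * s)"
    and "F \<equiv> L2_set (\<lambda>k. cmod (\<Sum>i<s. a i * cis (\<xi> i) ^ k
                + b i * (of_nat k * cis (\<xi> i) ^ (k - 1)))) {..2 * N}"
  shows "cmod (a j) \<le> 10 * s * 4 ^ s * (1 / h) ^ (2 * l - 1) * sqrt (s / N) * F"
    and "cmod (b j) \<le> 10 * s * 4 ^ s * (1 / h) ^ (2 * l - 1) * sqrt (s / N) * F"
proof -
  have \<Delta>: "\<Delta> > 0" and l: "2 \<le> l" "l \<le> s" and \<tau>: "1 \<le> \<tau>"
    using conf by (auto simp: clustered_config_def)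
  obtain R where R: "R \<subseteq> {..<s}" "j \<in> R" "card R \<le> l"
    and near: "\<And>i. i \<in> R - {j} \<Longrightarrow> \<Delta> \<le> wrap_dist (\<xi> i - \<xi> j) \<and> wrap_dist (\<xi> i - \<xi> j) \<le> \<tau> * \<Delta>"
    and far: "\<And>i. i \<in> {..<s} - R \<Longrightarrow> \<rho> \<le> wrap_dist (\<xi> i - \<xi> j)"
  proof -
    have "\<exists>R. R \<subseteq> {..<s} \<and> j \<in> R \<and> 1 \<le> card R \<and> card R \<le> l \<and>
        (\<forall>y\<in>R - {j}. \<Delta> \<le> wrap_dist (\<xi> y - \<xi> j) \<and> wrap_dist (\<xi> y - \<xi> j) \<le> \<tau> * \<Delta>) \<and>
        (\<forall>y\<in>{..<s} - R. wrap_dist (\<xi> y - \<xi> j) \<ge> \<rho>)"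
      using conf j unfolding clustered_config_def by simp
    then show thesis
      using that by blast
  qed
  have s: "2 \<le> s" using l by simp
  have \<rho>0: "0 < \<rho>"
  proof -
    have "0 < 4 * \<tau> * \<Delta>" using \<Delta> \<tau> by simp
    then show ?thesis using \<rho> by linarith
  qed
  \<comment> \<open>Rounding down keeps the degree \<open>2 * s * M\<close> within the available
    \<open>2 * N\<close>.\<close>
  define M where "M = N div s"
  have "real s * 4 \<le> real s * (4 * real s ^ 2)"
    using s by (intro mult_left_mono) (auto simp: one_le_power)
  also have "\<dots> \<le> N"
    using N(2) by (simp add: power3_eq_cube power2_eq_square algebra_simps)
  finally have N4: "4 * real s \<le> N" by simp
  have M_le: "real M * s \<le> N"
    unfolding M_def by (metis div_times_less_eq_dividend of_nat_le_iff of_nat_mult)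
  \<comment> \<open>Rounding loses less than \<open>s\<close>, at most a quarter of
    \<open>N\<close>, so a factor 2 absorbs it.\<close>
  have M_ge: "N \<le> 2 * real s * M"
  proof -
    have "N < s * M + s"
      unfolding M_def using s dividend_less_times_div[of s N] by simp
    then have "real N < real s * M + s"
      by (metis of_nat_add of_nat_less_iff of_nat_mult)
    then show ?thesis using N4 by simp
  qed
  have M0: "0 < M"
    using M_ge N4 s by (cases M) auto
  have N0: "0 < real N"
    using N4 s by simp
  have h0: "0 < h"
    using N0 \<Delta> s by (simp add: h_def)
  have N\<tau>: "N * (\<tau> * \<Delta>) \<le> pi * s"
    using N(3) \<Delta> \<tau> by (simp add: field_simps)
  have h1: "h \<le> 1"
  proof -
    have "N * \<Delta> \<le> N * (\<tau> * \<Delta>)"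
      using \<Delta> \<tau> by (intro mult_left_mono) auto
    then show ?thesis
      using N\<tau> s by (simp add: h_def)
  qed

  \<comment> \<open>For \<open>s \<ge> 2\<close> the box has half-width at most
    \<open>pi / 8\<close>, so differences stay below \<open>pi\<close> and no wraparound
    occurs.\<close>
  have dist: "\<bar>\<xi> j - \<xi> i\<bar> \<le> pi / 4" "wrap_dist (\<xi> i - \<xi> j) = \<bar>\<xi> j - \<xi> i\<bar>" if "i < s" for i
  proof -
    have "(2::real)\<^sup>2 \<le> (real s)\<^sup>2"
      using s by (intro power_mono) auto
    then have "pi / (2 * (real s)\<^sup>2) \<le> pi / (2 * 4)"
      using s by (intro divide_left_mono mult_pos_pos) auto
    then show "\<bar>\<xi> j - \<xi> i\<bar> \<le> pi / 4"
      using box[OF that] box[OF j] by linarith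
    then have "\<bar>\<xi> i - \<xi> j\<bar> < pi"
      using pi_gt_zero by linarith
    then show "wrap_dist (\<xi> i - \<xi> j) = \<bar>\<xi> j - \<xi> i\<bar>"
      by (simp add: wrap_dist_eq_abs abs_minus_commute)
  qed

  define I where "I = {..<s} - {j}"
  define d where "d i = (if i \<in> R then h else 1)" for i
  define L where "L i = (if i \<in> R then M else nat \<lfloor>pi / \<bar>\<xi> j - \<xi> i\<bar>\<rfloor>)" for i
  have L_le: "L i \<le> M" if "i \<in> I" for i
  proof (cases "i \<in> R")
    case False
    \<comment> \<open>Here \<open>L i \<le> pi / \<delta> \<le> pi / \<rho>\<close>, and the lower
      bound on \<open>N\<close> in terms of \<open>\<rho>\<close> gives
      \<open>L i * s \<le> N\<close>.\<close>
    define \<delta> where "\<delta> = \<bar>\<xi> j - \<xi> i\<bar>"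
    have \<delta>: "\<rho> \<le> \<delta>"
      using far[of i] dist[of i] that False by (auto simp: I_def \<delta>_def)
    have "real (L i) \<le> pi / \<delta>"
      using False \<delta> \<rho>0 by (simp add: L_def \<delta>_def)
    also have "\<dots> \<le> pi / \<rho>"
      using \<delta> \<rho>0 by (intro divide_left_mono) auto
    finally have "real (L i) * s \<le> pi / \<rho> * s"
      by (rule mult_right_mono) simp
    also have "\<dots> \<le> 4 * pi * s / \<rho>"
      using \<rho>0 by (simp add: field_simps)
    also have "\<dots> \<le> N"
      by (rule N)
    finally have "L i * s \<le> N"
      by (metis of_nat_le_iff of_nat_mult)
    then show ?thesis
      using s unfolding M_def by (simp add: less_eq_div_iff_mult_less_eq)
  qed (simp add: L_def)
  have d0: "0 < d i" "h \<le> d i" for i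
    using h0 h1 by (auto simp: d_def)
  have d_le: "d i \<le> cmod (cis (\<xi> j) ^ L i - cis (\<xi> i) ^ L i)" if "i \<in> I" for i
  proof (cases "i \<in> R")
    case True
    define \<delta> where "\<delta> = \<bar>\<xi> j - \<xi> i\<bar>"
    have \<delta>: "\<Delta> \<le> \<delta>" "\<delta> \<le> \<tau> * \<Delta>"
      using near[of i] dist[of i] that True by (auto simp: I_def \<delta>_def)
    \<comment> \<open>The upper bound on \<open>N\<close> keeps the \<open>M\<close>-th powers of
      cluster nodes within half a turn of each other.\<close>
    have "real s * (real M * \<delta>) \<le> N * (\<tau> * \<Delta>)"
      using mult_mono[OF M_le \<delta>(2)] \<delta> \<Delta> by (simp add: mult_ac)
    then have "real s * (real M * \<delta>) \<le> s * pi"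
      using N\<tau> by (simp add: mult_ac)
    then have le_pi: "real M * \<delta> \<le> pi"
      using s by simp
    \<comment> \<open>The 2 lost in rounding \<open>M\<close> cancels the 2 of Jordan's inequality;
      this explains the form of \<open>h\<close>.\<close>
    have "N * \<Delta> \<le> 2 * real s * M * \<delta>"
      using M_ge \<delta> \<Delta> by (intro mult_mono) auto
    then have "h \<le> 2 / pi * (real M * \<delta>)"
      using s by (simp add: h_def field_simps)
    also have "\<dots> \<le> cmod (cis (\<xi> j) ^ M - cis (\<xi> i) ^ M)"
      unfolding \<delta>_def by (rule norm_cis_power_diff_ge) (use le_pi in \<open>simp add: \<delta>_def\<close>)
    finally show ?thesis
      using True by (simp add: d_def L_def)
  next
    case False
    have "\<rho> \<le> \<bar>\<xi> j - \<xi> i\<bar>" "\<bar>\<xi> j - \<xi> i\<bar> \<le> pi / 4"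
      using far[of i] dist[of i] that False by (auto simp: I_def)
    then have "0 < \<bar>\<xi> j - \<xi> i\<bar>" "\<bar>\<xi> j - \<xi> i\<bar> \<le> pi / 2"
      using \<rho>0 pi_gt_zero by linarith+
    from exponent_separating_far[OF this] show ?thesis
      using False by (simp add: d_def L_def)
  qed

  define G where "G = (\<Prod>i\<in>I. (2 / d i)\<^sup>2) / sqrt M"
  define H where "H = 4 ^ s * (1 / h) ^ (2 * (l - 1)) / sqrt M"
  define X where "X = s / h * (H * F)"
  have F0: "0 \<le> F"
    by (simp add: F_def)
  have H0: "0 \<le> H"
    using h0 by (simp add: H_def)
  have cardI: "card I = s - 1"
    using j by (simp add: I_def)
  have GH: "G \<le> H"
  proof -
    have "card (I \<inter> R) = card (R - {j})"
      using R(1) by (intro arg_cong[of _ _ card]) (auto simp: I_def)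
    also have "\<dots> \<le> l - 1"
      using R finite_subset[OF R(1)] by simp
    finally show ?thesis
      unfolding G_def H_def d_def
      by (intro divide_right_mono prod_cluster_le h0 h1) (auto simp: cardI, simp add: I_def)
  qed
  have dual: "cmod (b j) \<le> 2 / M * G * F"
    "cmod (a j) \<le> G * F + cmod (b j) * ((\<Sum>i\<in>I. 2 * L i / d i) + M)"
    unfolding G_def F_def I_def
    using dual_polynomial_bounds[where z = "\<lambda>i. cis (\<xi> i)" and s = s and j = j and M = M
        and n = "2 * N" and L = L and d = d and a = a and b = b]
      j M0 M_le L_le d0 d_le
    by (auto simp: I_def M_def)
  have GFH: "G * F \<le> H * F"
    by (intro mult_right_mono GH F0)
  have b: "cmod (b j) \<le> 2 / M * (H * F)"
    using dual(1) mult_left_mono[OF GFH, of "2 / M"] M0 by simp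
  \<comment> \<open>This bounds \<open>T'(w)\<close>. Against the factor \<open>2 / M\<close> in the
    bound on \<open>b j\<close> it leaves a multiple of \<open>s / h\<close>, the one extra power of
    \<open>1 / h\<close>.\<close>
  have "(\<Sum>i\<in>I. 2 * L i / d i) + M \<le> 2 * s * (M / h)"
  proof -
    have "2 * L i / d i \<le> 2 * M / h" if "i \<in> I" for i
      using L_le[OF that] d0[of i] h0 by (intro frac_le) auto
    then have "(\<Sum>i\<in>I. 2 * L i / d i) \<le> real (s - 1) * (2 * M / h)"
      using sum_bounded_above[of I "\<lambda>i. 2 * L i / d i" "2 * M / h"] cardI by simp
    moreover have "real M \<le> 2 * M / h"
      using h0 h1 mult_mono[of h 1 "real M" "2 * real M"] by (simp add: field_simps)
    moreover have "real (s - 1) * (2 * M / h) + 2 * M / h = 2 * s * (M / h)"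
      using s h0 by (cases s) (auto simp: field_simps)
    ultimately show ?thesis by linarith
  qed
  then have "cmod (b j) * ((\<Sum>i\<in>I. 2 * L i / d i) + M) \<le> 2 / M * (H * F) * (2 * s * (M / h))"
    using b H0 F0 d0 M0
    by (intro mult_mono add_nonneg_nonneg sum_nonneg) (auto intro!: divide_nonneg_pos)
  also have "\<dots> = 4 * X"
    using M0 by (simp add: X_def)
  finally have "cmod (a j) \<le> H * F + 4 * X"
    using dual(2) GFH by linarith
  moreover have sh: "1 \<le> s / h"
    using s h0 h1 by (simp add: field_simps)
  then have "H * F \<le> X"
    unfolding X_def using H0 F0 mult_right_mono[OF sh, of "H * F"] by simp
  ultimately have a': "cmod (a j) \<le> 5 * X"
    by linarith
  \<comment> \<open>Since \<open>M \<ge> 1\<close>, \<open>2 / M\<close> is relaxed to 2, which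
    gives \<open>b j\<close> the same bound as \<open>a j\<close>.\<close>
  have "2 / M * (H * F) \<le> 2 * (H * F)"
    using M0 H0 F0 by (intro mult_right_mono) (auto simp: divide_le_eq)
  then have b': "cmod (b j) \<le> 5 * X"
    using b \<open>H * F \<le> X\<close> mult_nonneg_nonneg[OF H0 F0] by linarith

  have "5 * X \<le> 10 * s * 4 ^ s * (1 / h) ^ (2 * l - 1) * sqrt (s / N) * F"
  proof -
    \<comment> \<open>The constant 2 would do; 4 has a rational square root.\<close>
    have "1 / real M \<le> 4 * (s / N)"
      using M_ge M0 N0 by (simp add: field_simps)
    then have "sqrt (1 / real M) \<le> sqrt (2\<^sup>2 * (s / N))"
      by (intro real_sqrt_le_mono) simp
    then have M': "1 / sqrt M \<le> 2 * sqrt (s / N)"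
      unfolding real_sqrt_mult by (simp add: real_sqrt_divide)
    \<comment> \<open>The squared factors of at most \<open>l - 1\<close> neighbours account for
      \<open>2 * (l - 1)\<close> powers, the derivative of \<open>T\<close> for the last
      one.\<close>
    have l': "2 * l - 1 = Suc (2 * (l - 1))"
      using l by simp
    have "5 * X = 5 * s * 4 ^ s * (1 / h) ^ (2 * l - 1) * F * (1 / sqrt M)"
      unfolding l' X_def H_def by simp
    also have "\<dots> \<le> 5 * s * 4 ^ s * (1 / h) ^ (2 * l - 1) * F * (2 * sqrt (s / N))"
      using h0 F0 by (intro mult_left_mono M') auto
    finally show ?thesis by (simp add: mult_ac)
  qed
  with a' b' show "cmod (a j) \<le> 10 * s * 4 ^ s * (1 / h) ^ (2 * l - 1) * sqrt (s / N) * F"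
    "cmod (b j) \<le> 10 * s * 4 ^ s * (1 / h) ^ (2 * l - 1) * sqrt (s / N) * F"
    by linarith+
qed

section \<open>From coefficient bounds to the singular value\<close>

text \<open>The columns split into values and derivatives, so the two halves of \<open>v\<close>
  play the roles of \<open>a\<close> and \<open>b\<close>.\<close>

lemma conf_vandermonde_mult_vec:
  assumes "v \<in> carrier_vec (2 * s)" and "k < 2 * N + 1"
  shows "vec_index (conf_vandermonde N s \<xi> *\<^sub>v v) k = of_real (1 / sqrt (2 * real N)) *
    (\<Sum>i<s. vec_index v i * cis (\<xi> i) ^ k
      + vec_index v (s + i) * (of_nat k * cis (\<xi> i) ^ (k - 1)))"
proof -
  have "{..<2 * s} = {..<s} \<union> {s..<2 * s}"
    by auto
  moreover have "(\<Sum>j\<in>{s..<2 * s}. f j) = (\<Sum>i<s. f (s + i))" for f :: "nat \<Rightarrow> complex"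
    by (rule sum.reindex_bij_witness[of _ "\<lambda>i. s + i" "\<lambda>j. j - s"]) auto
  ultimately have split: "(\<Sum>j<2 * s. f j) = (\<Sum>i<s. f i + f (s + i))" for f :: "nat \<Rightarrow> complex"
    by (subst \<open>{..<2 * s} = _\<close>, subst sum.union_disjoint) (auto simp: sum.distrib)
  have "vec_index (conf_vandermonde N s \<xi> *\<^sub>v v) k
      = (\<Sum>j<2 * s. conf_vandermonde N s \<xi> $$ (k, j) * vec_index v j)"
    using assms
    by (auto simp: conf_vandermonde_def scalar_prod_def lessThan_atLeast0 intro!: sum.cong)
  also have "\<dots> = (\<Sum>i<s. of_real (1 / sqrt (2 * real N)) *
      (vec_index v i * cis (\<xi> i) ^ k + vec_index v (s + i) * (of_nat k * cis (\<xi> i) ^ (k - 1))))"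
    unfolding split using assms(2)
    by (intro sum.cong refl) (simp add: conf_vandermonde_def algebra_simps)
  finally show ?thesis
    by (simp only: sum_distrib_left)
qed

lemma sigma_min_conf_vandermonde_ge:
  fixes \<Delta> \<rho> \<tau> :: real and l s N :: nat
  assumes conf: "clustered_config \<Delta> \<rho> s l \<tau> \<xi>"
    and \<rho>: "4 * \<tau> * \<Delta> \<le> \<rho>"
    and box: "\<And>i. i < s \<Longrightarrow> \<bar>\<xi> i\<bar> \<le> pi / (2 * (real s)\<^sup>2)"
    and N: "4 * pi * s / \<rho> \<le> N" "4 * real s ^ 3 \<le> N" "N \<le> pi * s / (\<tau> * \<Delta>)"
  shows "(N * \<Delta> / (pi * s)) ^ (2 * l - 1) / (20 * (real s)\<^sup>2 * 4 ^ s)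
    \<le> sigma_min (conf_vandermonde N s \<xi>)"
proof (rule sigma_min_ge)
  show "conf_vandermonde N s \<xi> \<in> carrier_mat (2 * N + 1) (2 * s)"
    by (simp add: conf_vandermonde_def)
  have \<Delta>: "\<Delta> > 0" and s: "2 \<le> s"
    using conf by (auto simp: clustered_config_def)
  then show "0 < 2 * s"
    by simp
  have "0 < 4 * real s ^ 3"
    using s by simp
  then have N0: "0 < real N"
    using N(2) by linarith
  define h where "h = N * \<Delta> / (pi * s)"
  have h0: "0 < h"
    using N0 \<Delta> s by (simp add: h_def)
  show "0 \<le> (N * \<Delta> / (pi * s)) ^ (2 * l - 1) / (20 * (real s)\<^sup>2 * 4 ^ s)"
    using \<Delta> by simp
  fix v :: "complex Matrix.vec"
  assume v: "v \<in> carrier_vec (2 * s)"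
  define F where "F = L2_set (\<lambda>k. cmod (\<Sum>i<s. vec_index v i * cis (\<xi> i) ^ k
      + vec_index v (s + i) * (of_nat k * cis (\<xi> i) ^ (k - 1)))) {..2 * N}"
  define W where "W = L2_set (\<lambda>k. cmod (vec_index (conf_vandermonde N s \<xi> *\<^sub>v v) k)) {..<2 * N + 1}"
  define Q where "Q = 10 * s * 4 ^ s * (1 / h) ^ (2 * l - 1) * sqrt (s / N) * F"
  have "W = L2_set (\<lambda>k. 1 / sqrt (2 * real N) * cmod (\<Sum>i<s. vec_index v i * cis (\<xi> i) ^ k
      + vec_index v (s + i) * (of_nat k * cis (\<xi> i) ^ (k - 1)))) {..2 * N}"
    unfolding W_def
  proof (rule L2_set_cong)
    show "{..<2 * N + 1} = {..2 * N}"
      by (simp add: lessThan_Suc_atMost)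
    fix k assume "k \<in> {..2 * N}"
    then show "cmod (vec_index (conf_vandermonde N s \<xi> *\<^sub>v v) k) = 1 / sqrt (2 * real N) *
        cmod (\<Sum>i<s. vec_index v i * cis (\<xi> i) ^ k
          + vec_index v (s + i) * (of_nat k * cis (\<xi> i) ^ (k - 1)))"
      by (subst conf_vandermonde_mult_vec[OF v]) (simp_all add: norm_mult norm_divide del: sum.distrib)
  qed
  also have "\<dots> = 1 / sqrt (2 * real N) * F"
    unfolding F_def by (rule L2_set_right_distrib[symmetric]) simp
  finally have "W = 1 / sqrt (2 * real N) * F" .
  then have F: "F = sqrt (2 * real N) * W"
    using N0 by simp
  have Q: "cmod (vec_index v i) \<le> Q" if "i < 2 * s" for i
  proof (cases "i < s")
    case True
    show ?thesis
      unfolding Q_def F_def h_def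
      by (rule cluster_coefficient_bounds(1)[OF conf \<rho> box N True,
            where a = "vec_index v" and b = "\<lambda>i. vec_index v (s + i)"])
  next
    case False
    then show ?thesis
      unfolding Q_def F_def h_def
      using cluster_coefficient_bounds(2)[OF conf \<rho> box N, where j = "i - s"
            and a = "vec_index v" and b = "\<lambda>i. vec_index v (s + i)"] that by simp
  qed
  have Q0: "0 \<le> Q"
    using h0 by (simp add: Q_def F_def)
  \<comment> \<open>Each of the \<open>2 * s\<close> entries is at most \<open>Q\<close>, so the
    Euclidean norm costs a factor \<open>sqrt (2 * s)\<close>.\<close>
  have "L2_set (\<lambda>i. cmod (vec_index v i)) {..<2 * s} \<le> L2_set (\<lambda>i. Q) {..<2 * s}"
    by (intro L2_set_mono) (auto simp: Q)
  also have "\<dots> = sqrt (2 * s) * Q"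
    using Q0 by (simp add: L2_set_constant)
  also have "\<dots> = 10 * s * 4 ^ s * (1 / h) ^ (2 * l - 1) * W
      * (sqrt (2 * s) * sqrt (s / N) * sqrt (2 * real N))"
    unfolding Q_def F by simp
  \<comment> \<open>The powers of \<open>N\<close> cancel: the gain from averaging exactly offsets
    the normalization of the matrix.\<close>
  also have "sqrt (2 * s) * sqrt (s / N) * sqrt (2 * real N) = 2 * s"
  proof -
    have "2 * real s * (s / N) * (2 * N) = (2 * real s)\<^sup>2"
      using N0 by (simp add: power2_eq_square)
    then show ?thesis
      unfolding real_sqrt_mult[symmetric] by (simp add: real_sqrt_mult)
  qed
  also have "10 * s * 4 ^ s * (1 / h) ^ (2 * l - 1) * W * (2 * s)
      = 20 * (real s)\<^sup>2 * 4 ^ s / h ^ (2 * l - 1) * W"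
    by (simp add: power2_eq_square power_divide)
  finally have le: "L2_set (\<lambda>i. cmod (vec_index v i)) {..<2 * s}
      \<le> 20 * (real s)\<^sup>2 * 4 ^ s / h ^ (2 * l - 1) * W" .
  have "h ^ (2 * l - 1) / (20 * (real s)\<^sup>2 * 4 ^ s) * L2_set (\<lambda>i. cmod (vec_index v i)) {..<2 * s}
      \<le> h ^ (2 * l - 1) / (20 * (real s)\<^sup>2 * 4 ^ s)
        * (20 * (real s)\<^sup>2 * 4 ^ s / h ^ (2 * l - 1) * W)"
    using h0 by (intro mult_left_mono le) simp
  also have "\<dots> = W"
    using h0 s by simp
  finally show "(N * \<Delta> / (pi * s)) ^ (2 * l - 1) / (20 * (real s)\<^sup>2 * 4 ^ s)
      * L2_set (\<lambda>i. cmod (vec_index v i)) {..<2 * s}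
      \<le> L2_set (\<lambda>k. cmod (vec_index (conf_vandermonde N s \<xi> *\<^sub>v v) k)) {..<2 * N + 1}"
    unfolding h_def W_def .
qed

theorem theorem3p1:
  fixes s :: nat
  shows "\<exists>C1 :: real. C1 > 0 \<and>
    (\<forall>(\<Delta>::real) (\<rho>::real) (l::nat) (\<tau>::real) (\<xi>::nat \<Rightarrow> real) (N::nat).
       \<Delta> > 0 \<and> \<rho> \<ge> 0 \<and> 2 \<le> l \<and> l \<le> s \<and> real l - 1 \<le> \<tau> \<and> \<tau> \<le> pi / \<Delta> \<and>
       4 * \<tau> * \<Delta> \<le> min \<rho> (1 / (real s)^2) \<and>
       (\<forall>j<s. - pi / (2 * (real s)^2) < \<xi> j \<and> \<xi> j \<le> pi / (2 * (real s)^2)) \<and>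
       clustered_config \<Delta> \<rho> s l \<tau> \<xi> \<and>
       max (4 * pi * real s / \<rho>) (4 * (real s)^3) \<le> real N \<and>
       real N \<le> pi * real s / (\<tau> * \<Delta>)
       \<longrightarrow> sigma_min (conf_vandermonde N s \<xi>) \<ge> C1 * (real N * \<Delta>) ^ (2 * l - 1))"
proof (cases "2 \<le> s")
  case True
  \<comment> \<open>The power \<open>(pi * s)^(2 * l - 1)\<close> is replaced by
    \<open>(pi * s)^(2 * s)\<close>, which dominates it since \<open>l \<le> s\<close> and
    \<open>pi * s \<ge> 1\<close>; thus \<open>C\<close> depends on \<open>s\<close> alone.\<close>
  define C where "C = 1 / ((pi * s) ^ (2 * s) * (20 * (real s)\<^sup>2 * 4 ^ s))"
  have "C > 0"
    using True by (simp add: C_def)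
  moreover have "C * (real N * \<Delta>) ^ (2 * l - 1) \<le> sigma_min (conf_vandermonde N s \<xi>)"
    if \<Delta>: "\<Delta> > 0" and l: "l \<le> s" and sep: "4 * \<tau> * \<Delta> \<le> min \<rho> (1 / (real s)^2)"
      and box: "\<forall>j<s. - pi / (2 * (real s)^2) < \<xi> j \<and> \<xi> j \<le> pi / (2 * (real s)^2)"
      and conf: "clustered_config \<Delta> \<rho> s l \<tau> \<xi>"
      and N: "max (4 * pi * real s / \<rho>) (4 * (real s)^3) \<le> real N"
        "real N \<le> pi * real s / (\<tau> * \<Delta>)"
    for \<Delta> \<rho> \<tau> :: real and l N :: nat and \<xi> :: "nat \<Rightarrow> real"
  proof -
    have "1 \<le> pi * s"
      using True pi_gt3 mult_mono[of 1 pi 1 "real s"] by simp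
    then have "(pi * s) ^ (2 * l - 1) \<le> (pi * s) ^ (2 * s)"
      using l by (intro power_increasing) auto
    then have "(real N * \<Delta>) ^ (2 * l - 1) / (pi * s) ^ (2 * s)
        \<le> (real N * \<Delta>) ^ (2 * l - 1) / (pi * s) ^ (2 * l - 1)"
      using True \<Delta> by (intro divide_left_mono) auto
    then have "(real N * \<Delta>) ^ (2 * l - 1) / (pi * s) ^ (2 * s) / (20 * (real s)\<^sup>2 * 4 ^ s)
        \<le> (N * \<Delta> / (pi * s)) ^ (2 * l - 1) / (20 * (real s)\<^sup>2 * 4 ^ s)"
      unfolding power_divide by (rule divide_right_mono) simp
    also have "\<dots> \<le> sigma_min (conf_vandermonde N s \<xi>)"
    proof (rule sigma_min_conf_vandermonde_ge[OF conf])
      show "\<bar>\<xi> i\<bar> \<le> pi / (2 * (real s)\<^sup>2)" if "i < s" for i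
        using box that by (fastforce simp: abs_le_iff)
      show "4 * \<tau> * \<Delta> \<le> \<rho>" "4 * pi * s / \<rho> \<le> N" "4 * real s ^ 3 \<le> N"
        "N \<le> pi * s / (\<tau> * \<Delta>)"
        using sep N by simp_all
    qed
    finally show ?thesis
      by (simp add: C_def)
  qed
  ultimately show ?thesis
    by (intro exI[of _ C] conjI allI impI; (elim conjE)?) assumption+
next
  case False
  \<comment> \<open>No \<open>l\<close> satisfies \<open>2 \<le> l\<close> and
    \<open>l \<le> s\<close>, so the claim is vacuous and any positive constant serves.\<close>
  then show ?thesis
    by (intro exI[of _ 1]) auto
qed

end
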